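(* Let $c,d,e\ge 0$ with $c+d+e=1$ and $e\in[0,1)$, and let $V:S^2\to S^2$ be given by $V(x_1,x_2,x_3)=(x_1',x_2',x_3')$ with $$x_1'=cx_3^2+2x_2x_3,\qquad x_2'=dx_3^2+2x_1x_3,\qquad x_3'=(1-x_3)^2+ex_3^2 .$$ 1. If $e<\frac14$, then there exists an open set $\mathcal U\subset S^2$ such that $\overline{x},\overline{\overline{x}}\in\mathcal U$ and for any $x^0=(x_1^0,x_2^0,x_3^0)\in\mathcal U$ we have $$\lim_{n\to\infty}V^n(x^0)=\begin{cases}\overline{x}, & \text{if } x_3^0\ne x_3^* \text{ and } n=2k,\\ x^*, & \text{if } x_3^0=x_3^*,\\ \overline{\overline{x}}, & \text{if } x_3^0\ne x_3^* \text{ and } n=2k+1,\end{cases}$$ that is, if $x_3^0\neq x_3^*$ the even iterates converge to $\overline{x}$ and the odd iterates converge to $\overline{\overline{x}}$, while if $x_3^0=x_3^*$ the whole trajectory converges to $x^*$. Here $x^*=(x_1^*,x_2^*,x_3^* )$ is the fixed point of $V$, and $\overline{x}=(\overline{x}_1,\overline{x}_2,\overline{x}_3)$, $\overline{\overline{x}}=(\overline{\overline{x}}_1,\overline{\overline{x}}_2,\overline{\overline{x}}_3)$ are the 2-periodic points of $V$ described in the context. 2. If $e\ge\frac14$, then there exists an open set $U\subset S^2$ such that $x^*\in U$ and for any $x^0=(x_1^0,x_2^0,x_3^0)\in U$ we have $$\lim_{n\to\infty}V^n(x_1^0,x_2^0,x_3^0)=(x_1^*,x_2^*,x_3^* ).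$$
   Context: $S^2=\{(x_1,x_2,x_3)\in\mathbb{R}^3: x_i\ge 0,\ x_1+x_2+x_3=1\}$. $V^n$ denotes the $n$-fold iterate of $V$. For $e\in[0,1)$ the operator $V$ has a unique fixed point $x^*=(x_1^*,x_2^*,x_3^* )$ in $S^2$, and $x_3^*=\frac{3-\sqrt{5-4e}}{2(1+e)}$. For $e<\frac14$, the map $\varphi(x)=(1-x)^2+ex^2$ (which governs the third coordinate) interchanges the two numbers $$\overline{x}_3=\frac{1+\sqrt{1-4e}}{2(1+e)},\qquad \overline{\overline{x}}_3=\frac{1-\sqrt{1-4e}}{2(1+e)},$$ and $\overline{x}$, $\overline{\overline{x}}$ are the 2-periodic points of $V$ with third coordinates $\overline{x}_3$, $\overline{\overline{x}}_3$ respectively: their first two coordinates are obtained by substituting $x_3=\overline{x}_3$, respectively $x_3=\overline{\overline{x}}_3$, into the first two equations of $V^2(x)=x$ and solving for $x_1,x_2$.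
   Formalization: In part 1 the printed limits are proved for x_3^0 > x_3^*; for x_3^0 < x_3^* the two limits are swapped (even iterates tend to the second periodic point, odd to the first), because that second point lies in U and is fixed by V^2, so the printed claim fails there. *)

theory Defs
  imports "HOL-Analysis.Analysis"
begin

definition S2 :: "(real ^ 3) set"
  where "S2 = {x. x $ 1 \<ge> 0 \<and> x $ 2 \<ge> 0 \<and> x $ 3 \<ge> 0 \<and> x $ 1 + x $ 2 + x $ 3 = 1}"

definition V :: "real \<Rightarrow> real \<Rightarrow> real \<Rightarrow> real ^ 3 \<Rightarrow> real ^ 3"
  where "V c d e x =
    vector [c * (x $ 3)\<^sup>2 + 2 * x $ 2 * x $ 3,
            d * (x $ 3)\<^sup>2 + 2 * x $ 1 * x $ 3,
            (1 - x $ 3)\<^sup>2 + e * (x $ 3)\<^sup>2]"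

definition x_star :: "real \<Rightarrow> real \<Rightarrow> real \<Rightarrow> real ^ 3"
  where "x_star c d e = (THE x. x \<in> S2 \<and> V c d e x = x)"

definition two_periodic :: "('a \<Rightarrow> 'a) \<Rightarrow> 'a \<Rightarrow> bool"
  where "two_periodic f x \<longleftrightarrow> (f ^^ 2) x = x \<and> f x \<noteq> x"

definition x3_bar :: "real \<Rightarrow> real"
  where "x3_bar e = (1 + sqrt (1 - 4 * e)) / (2 * (1 + e))"

definition x3_barbar :: "real \<Rightarrow> real"
  where "x3_barbar e = (1 - sqrt (1 - 4 * e)) / (2 * (1 + e))"

definition x_bar :: "real \<Rightarrow> real \<Rightarrow> real \<Rightarrow> real ^ 3"
  where "x_bar c d e = (THE x. x \<in> S2 \<and> two_periodic (V c d e) x \<and> x $ 3 = x3_bar e)"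

definition x_barbar :: "real \<Rightarrow> real \<Rightarrow> real \<Rightarrow> real ^ 3"
  where "x_barbar c d e = (THE x. x \<in> S2 \<and> two_periodic (V c d e) x \<and> x $ 3 = x3_barbar e)"

text \<open>The definite descriptions above are well defined: the following facts establish existence
  and uniqueness, the closed form of the third coordinate of the fixed point, and the fact
  that \<open>V\<close> interchanges the two periodic points.\<close>

lemma V_nth [simp]:
  "V c d e x $ 1 = c * (x $ 3)\<^sup>2 + 2 * x $ 2 * x $ 3"
  "V c d e x $ 2 = d * (x $ 3)\<^sup>2 + 2 * x $ 1 * x $ 3"
  "V c d e x $ 3 = (1 - x $ 3)\<^sup>2 + e * (x $ 3)\<^sup>2"
  by (simp_all add: V_def)

lemma V_in_S2:
  assumes "c \<ge> 0" "d \<ge> 0" "e \<ge> 0" "c + d + e = 1" "x \<in> S2"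
  shows "V c d e x \<in> S2"
proof -
  have c: "c = 1 - d - e" and x: "x $ 1 = 1 - x $ 2 - x $ 3"
    using assms by (auto simp: S2_def)
  have "V c d e x $ 1 + V c d e x $ 2 + V c d e x $ 3 = 1"
    unfolding V_nth x c by algebra
  then show ?thesis using assms by (simp add: S2_def)
qed

lemma ex1_V_V_fixed:
  fixes a b :: real
  assumes "c \<ge> 0" "d \<ge> 0" "c + d + e = 1" "0 \<le> a" "a \<le> 1" "0 \<le> b" "4 * a * b < 1"
    and ab: "b = (1 - a)\<^sup>2 + e * a\<^sup>2" and ba: "a = (1 - b)\<^sup>2 + e * b\<^sup>2"
  shows "\<exists>!x. x \<in> S2 \<and> V c d e (V c d e x) = x \<and> x $ 3 = a"
proof -
  define p q where "p = (c * b\<^sup>2 + 2 * d * a\<^sup>2 * b) / (1 - 4 * a * b)"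
    and "q = (d * b\<^sup>2 + 2 * c * a\<^sup>2 * b) / (1 - 4 * a * b)"
  have e: "e = 1 - c - d" using assms(1-7) by simp
  have p: "p * (1 - 4 * a * b) = c * b\<^sup>2 + 2 * d * a\<^sup>2 * b"
    and q: "q * (1 - 4 * a * b) = d * b\<^sup>2 + 2 * c * a\<^sup>2 * b"
    using assms(1-7) unfolding p_def q_def by simp_all
  have "p \<ge> 0" "q \<ge> 0" using assms(1-7) by (auto simp: p_def q_def)
  have "(1 - a) = (1 - e) * b\<^sup>2 + 2 * b * (1 - b)" using ba by algebra
  moreover have "(1 - b) = (1 - e) * a\<^sup>2 + 2 * a * (1 - a)" using ab by algebra
  ultimately have "(1 - a) * (1 - 4 * a * b) = (1 - e) * (b\<^sup>2 + 2 * a\<^sup>2 * b)" by algebra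
  then have "(1 - a) * (1 - 4 * a * b) = (p + q) * (1 - 4 * a * b)"
    using p q e by algebra
  then have sum: "p + q + a = 1" using assms(1-7) by simp
  have in1: "c * b\<^sup>2 + 2 * (d * a\<^sup>2 + 2 * p * a) * b = p" using p by algebra
  have in2: "d * b\<^sup>2 + 2 * (c * a\<^sup>2 + 2 * q * a) * b = q" using q by algebra
  show ?thesis
  proof (rule ex1I [of _ "vector [p, q, a]"])
    show "vector [p, q, a] \<in> S2 \<and> V c d e (V c d e (vector [p, q, a])) = vector [p, q, a]
        \<and> (vector [p, q, a] :: real ^ 3) $ 3 = a"
      using \<open>p \<ge> 0\<close> \<open>q \<ge> 0\<close> \<open>0 \<le> a\<close> sum
      by (simp only: S2_def vec_eq_iff forall_3 V_nth vector_3 mem_Collect_eq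
            ab [symmetric] ba [symmetric] in1 in2 simp_thms)
  next
    fix y :: "real ^ 3"
    assume y: "y \<in> S2 \<and> V c d e (V c d e y) = y \<and> y $ 3 = a"
    then have "V c d e (V c d e y) $ 1 = y $ 1" "V c d e (V c d e y) $ 2 = y $ 2" "y $ 3 = a"
      by auto
    then have "c * b\<^sup>2 + 2 * (d * a\<^sup>2 + 2 * y $ 1 * a) * b = y $ 1"
      "d * b\<^sup>2 + 2 * (c * a\<^sup>2 + 2 * y $ 2 * a) * b = y $ 2"
      by (simp_all only: V_nth ab [symmetric])
    then have "y $ 1 * (1 - 4 * a * b) = p * (1 - 4 * a * b)"
      "y $ 2 * (1 - 4 * a * b) = q * (1 - 4 * a * b)"
      unfolding p q by (simp_all add: algebra_simps)
    then have "y $ 1 = p" "y $ 2 = q" using assms(1-7) by simp_all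
    then show "y = vector [p, q, a]" using \<open>y $ 3 = a\<close> by (simp add: vec_eq_iff forall_3)
  qed
qed

lemma ex1_fixed_point:
  assumes "c \<ge> 0" "d \<ge> 0" "e \<ge> 0" "e < 1" "c + d + e = 1"
  shows "\<exists>!x. x \<in> S2 \<and> V c d e x = x"
    and "x \<in> S2 \<Longrightarrow> V c d e x = x \<Longrightarrow> x $ 3 = (3 - sqrt (5 - 4 * e)) / (2 * (1 + e))"
proof -
  define s where "s = sqrt (5 - 4 * e)"
  define r where "r = (3 - s) / (2 * (1 + e))"
  have s2: "s\<^sup>2 = 5 - 4 * e" using assms by (simp add: s_def)
  have s1: "s > 1" using assms by (simp add: s_def real_less_rsqrt)
  have s3: "s < 3" using assms by (simp add: s_def real_less_lsqrt)
  have rr: "2 * (1 + e) * r = 3 - s" using assms by (simp add: r_def)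
  have r0: "r > 0" using s3 assms by (simp add: r_def)
  have "e * e < 1" using mult_strict_mono[of e 1 e 1] assms by simp
  then have "(2 - e)\<^sup>2 < s\<^sup>2" unfolding s2 by (simp add: power2_eq_square algebra_simps)
  then have "s > 2 - e" by (rule power2_less_imp_less) (use s1 in simp)
  then have r1: "r < 1/2" using assms by (simp add: r_def field_simps)
  have root: "x = r" if "x = (1 - x)\<^sup>2 + e * x\<^sup>2" "x \<le> 1" for x
  proof -
    have "(2 * (1 + e) * x - (3 - s)) * (2 * (1 + e) * x - (3 + s)) = 0"
      using that(1) s2 by algebra
    moreover have "2 * (1 + e) * x < 3 + s"
    proof -
      have "2 * (1 + e) * x \<le> 2 * (1 + e)" using that assms by simp
      also have "\<dots> < 3 + s" using assms s1 by simp
      finally show ?thesis .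
    qed
    ultimately have "2 * (1 + e) * x = 2 * (1 + e) * r"
      unfolding rr by simp
    then show ?thesis using assms(3) by simp
  qed
  have "(1 + e) * ((1 - r)\<^sup>2 + e * r\<^sup>2 - r) = 0" using rr s2 by algebra
  then have rfix: "r = (1 - r)\<^sup>2 + e * r\<^sup>2" using assms by simp
  have "4 * r * r < 1"
    using mult_strict_mono[OF r1 r1] r0 by simp
  have "0 \<le> r" "r \<le> 1" using r0 r1 by simp_all
  note ex1 = ex1_V_V_fixed[OF assms(1,2,5) \<open>0 \<le> r\<close> \<open>r \<le> 1\<close> \<open>0 \<le> r\<close> \<open>4 * r * r < 1\<close> rfix rfix]
  then obtain w where w: "w \<in> S2" "V c d e (V c d e w) = w" "w $ 3 = r" by blast
  then have "V c d e w \<in> S2" "V c d e (V c d e (V c d e w)) = V c d e w" "V c d e w $ 3 = r"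
    using V_in_S2[OF assms(1-3,5)] by (simp_all only: V_nth rfix [symmetric])
  with ex1 w have Vw: "V c d e w = w" by blast
  have third: "y $ 3 = r" if "y \<in> S2" "V c d e y = y" for y
  proof (rule root)
    show "y $ 3 = (1 - y $ 3)\<^sup>2 + e * (y $ 3)\<^sup>2" using that(2) V_nth(3) by metis
    show "y $ 3 \<le> 1" using that(1) by (simp add: S2_def)
  qed
  show "\<exists>!x. x \<in> S2 \<and> V c d e x = x"
  proof (rule ex1I [of _ w])
    fix y assume y: "y \<in> S2 \<and> V c d e y = y"
    then have "y $ 3 = r" using third by blast
    with y w ex1 show "y = w" by metis
  qed (use w Vw in blast)
  show "x \<in> S2 \<Longrightarrow> V c d e x = x \<Longrightarrow> x $ 3 = (3 - sqrt (5 - 4 * e)) / (2 * (1 + e))"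
    using third unfolding r_def s_def .
qed

lemma x_star:
  assumes "c \<ge> 0" "d \<ge> 0" "e \<ge> 0" "e < 1" "c + d + e = 1"
  shows "x_star c d e \<in> S2" "V c d e (x_star c d e) = x_star c d e"
    and "x_star c d e $ 3 = (3 - sqrt (5 - 4 * e)) / (2 * (1 + e))"
  using theI'[OF ex1_fixed_point(1)[OF assms]] ex1_fixed_point(2)[OF assms]
  unfolding x_star_def by blast+

lemma x3_bar_barbar:
  assumes "e \<ge> 0" "e < 1/4"
  defines "a \<equiv> x3_bar e" and "b \<equiv> x3_barbar e"
  shows "0 \<le> b" "b < a" "a \<le> 1" "4 * a * b < 1"
    and "b = (1 - a)\<^sup>2 + e * a\<^sup>2" "a = (1 - b)\<^sup>2 + e * b\<^sup>2"
proof -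
  define s where "s = sqrt (1 - 4 * e)"
  have s2: "s\<^sup>2 = 1 - 4 * e" and s0: "s > 0" and s1: "s \<le> 1"
    using assms by (simp_all add: s_def)
  have A: "2 * (1 + e) * a = 1 + s" and B: "2 * (1 + e) * b = 1 - s"
    using assms by (simp_all add: x3_bar_def x3_barbar_def s_def)
  show "0 \<le> b" using assms s1 by (simp add: x3_barbar_def s_def)
  show "b < a" using assms s0 by (simp add: x3_bar_def x3_barbar_def s_def divide_strict_right_mono)
  have "s \<le> 1 + 2 * e" using assms(1) s1 by linarith
  then show "a \<le> 1" using assms(1) unfolding a_def x3_bar_def s_def[symmetric] by simp
  have "(1 + e)\<^sup>2 * (4 * a * b) = (2 * (1 + e) * a) * (2 * (1 + e) * b)"
    by (simp only: power2_eq_square mult_ac)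
  also have "\<dots> = 4 * e" unfolding A B using s2 by algebra
  finally have ab: "(1 + e)\<^sup>2 * (4 * a * b) = 4 * e" .
  have "(1 - e)\<^sup>2 > 0" using assms by simp
  then have "4 * e < (1 + e)\<^sup>2" by (simp add: power2_eq_square algebra_simps)
  with ab have "(1 + e)\<^sup>2 * (4 * a * b) < (1 + e)\<^sup>2 * 1" by simp
  then show "4 * a * b < 1" by (rule mult_left_less_imp_less) simp
  have "(1 + e) * ((1 - a)\<^sup>2 + e * a\<^sup>2 - b) = 0" using A B s2 by algebra
  then show "b = (1 - a)\<^sup>2 + e * a\<^sup>2" using assms by simp
  have "(1 + e) * ((1 - b)\<^sup>2 + e * b\<^sup>2 - a) = 0" using A B s2 by algebra
  then show "a = (1 - b)\<^sup>2 + e * b\<^sup>2" using assms by simp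
qed

lemma ex1_two_periodic:
  assumes "c \<ge> 0" "d \<ge> 0" "e \<ge> 0" "e < 1/4" "c + d + e = 1"
  shows "\<exists>!x. x \<in> S2 \<and> two_periodic (V c d e) x \<and> x $ 3 = x3_bar e"
    and "\<exists>!x. x \<in> S2 \<and> two_periodic (V c d e) x \<and> x $ 3 = x3_barbar e"
proof -
  note * = x3_bar_barbar[OF assms(3,4)]
  have ne: "V c d e x \<noteq> x" if "x $ 3 = x3_bar e \<or> x $ 3 = x3_barbar e" for x
  proof
    assume "V c d e x = x"
    then have "(1 - x $ 3)\<^sup>2 + e * (x $ 3)\<^sup>2 = x $ 3" using V_nth(3) by metis
    then have "x $ 3 \<noteq> x3_bar e" "x $ 3 \<noteq> x3_barbar e" using *(2,5,6) by (metis less_irrefl)+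
    with that show False by blast
  qed
  have eq: "(x \<in> S2 \<and> two_periodic (V c d e) x \<and> x $ 3 = t) \<longleftrightarrow>
      (x \<in> S2 \<and> V c d e (V c d e x) = x \<and> x $ 3 = t)"
    if "t = x3_bar e \<or> t = x3_barbar e" for x t
    using ne that by (auto simp: two_periodic_def numeral_2_eq_2)
  have ab1: "0 \<le> x3_bar e" "x3_barbar e \<le> 1" using *(1-3) by linarith+
  have ab2: "4 * x3_barbar e * x3_bar e < 1" using *(4) by (simp only: mult_ac)
  show "\<exists>!x. x \<in> S2 \<and> two_periodic (V c d e) x \<and> x $ 3 = x3_bar e"
    unfolding eq[OF disjI1[OF refl]]
    by (rule ex1_V_V_fixed[OF assms(1,2,5) ab1(1) *(3,1,4,5,6)])
  show "\<exists>!x. x \<in> S2 \<and> two_periodic (V c d e) x \<and> x $ 3 = x3_barbar e"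
    unfolding eq[OF disjI2[OF refl]]
    by (rule ex1_V_V_fixed[OF assms(1,2,5) *(1) ab1(2,1) ab2 *(6,5)])
qed

lemma
  assumes "c \<ge> 0" "d \<ge> 0" "e \<ge> 0" "e < 1/4" "c + d + e = 1"
  shows x_bar: "x_bar c d e \<in> S2" "two_periodic (V c d e) (x_bar c d e)"
      "x_bar c d e $ 3 = x3_bar e"
    and x_barbar: "x_barbar c d e \<in> S2" "two_periodic (V c d e) (x_barbar c d e)"
      "x_barbar c d e $ 3 = x3_barbar e"
  using theI'[OF ex1_two_periodic(1)[OF assms]] theI'[OF ex1_two_periodic(2)[OF assms]]
  unfolding x_bar_def x_barbar_def by blast+

lemma V_interchanges:
  assumes "c \<ge> 0" "d \<ge> 0" "e \<ge> 0" "e < 1/4" "c + d + e = 1"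
  shows "V c d e (x_bar c d e) = x_barbar c d e" "V c d e (x_barbar c d e) = x_bar c d e"
proof -
  have "V c d e (x_bar c d e) \<in> S2" using x_bar(1) V_in_S2 assms by auto
  moreover have "two_periodic (V c d e) (V c d e (x_bar c d e))"
    using x_bar(2)[OF assms] by (auto simp: two_periodic_def numeral_2_eq_2)
  moreover have "V c d e (x_bar c d e) $ 3 = x3_barbar e"
    using x_bar(3)[OF assms] x3_bar_barbar(5)[OF assms(3,4)] by (simp only: V_nth)
  ultimately show 1: "V c d e (x_bar c d e) = x_barbar c d e"
    using x_barbar[OF assms] ex1_two_periodic(2)[OF assms] by blast
  show "V c d e (x_barbar c d e) = x_bar c d e"
    using x_bar(2)[OF assms] by (simp add: 1[symmetric] two_periodic_def numeral_2_eq_2)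
qed

text \<open>Even iterates starting at \<open>x_barbar\<close> stay at \<open>x_barbar\<close>. Hence no set containing both
  periodic points can have all its even iterates (off the level \<open>x\<^sub>3 = x\<^sub>3\<^sup>*\<close>) converge to
  \<open>x_bar\<close>; which of the two points attracts the even iterates depends on the side of
  \<open>x\<^sub>3\<^sup>*\<close> on which the third coordinate of the starting point lies.\<close>

lemma even_iterates_not_uniform:
  assumes "c \<ge> 0" "d \<ge> 0" "e \<ge> 0" "e < 1/4" "c + d + e = 1" and U: "x_barbar c d e \<in> U"
  shows "\<not> (\<forall>x\<in>U. x $ 3 \<noteq> x_star c d e $ 3 \<longrightarrow>
              (\<lambda>k. (V c d e ^^ (2 * k)) x) \<longlonglongrightarrow> x_bar c d e)"
proof
  let ?y = "x_barbar c d e"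
  assume all: "\<forall>x\<in>U. x $ 3 \<noteq> x_star c d e $ 3 \<longrightarrow>
              (\<lambda>k. (V c d e ^^ (2 * k)) x) \<longlonglongrightarrow> x_bar c d e"
  note sw = V_interchanges[OF assms(1-5)]
  note b = x3_bar_barbar[OF assms(3,4)]
  have const: "(V c d e ^^ (2 * k)) ?y = ?y" for k
    by (induction k) (simp_all add: sw)
  have "e < 1" using assms by simp
  have "?y $ 3 \<noteq> x_star c d e $ 3"
  proof
    assume "?y $ 3 = x_star c d e $ 3"
    then have "V c d e ?y $ 3 = V c d e (x_star c d e) $ 3" by simp
    then show False
      using x_star(2)[OF assms(1-3) \<open>e < 1\<close> assms(5)] x_bar(3)[OF assms(1-5)]
        x_barbar(3)[OF assms(1-5)] \<open>?y $ 3 = x_star c d e $ 3\<close> sw b(2) by auto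
  qed
  with all U have "(\<lambda>k. (V c d e ^^ (2 * k)) ?y) \<longlonglongrightarrow> x_bar c d e" by blast
  then have "?y = x_bar c d e" by (simp add: const LIMSEQ_const_iff)
  then show False using x_bar(3)[OF assms(1-5)] x_barbar(3)[OF assms(1-5)] b(2) by simp
qed

end

theory Submission
  imports Defs
begin

text \<open>
  In the coordinate \<open>u = (1 + e) x\<^sub>3 - 1\<close> the third component of \<open>V\<close> becomes \<open>u \<mapsto> u\<^sup>2 - k\<close> with
  \<open>k = 1 - e\<close>.  This map is decreasing on the invariant interval \<open>[-k, 0]\<close>, so its second iterate is
  increasing there and even orbits are monotone.  They converge to a root of
  \<open>(u\<^sup>2 - k)\<^sup>2 - k - u = (u\<^sup>2 - k - u) (u\<^sup>2 + u + 1 - k)\<close>.  For \<open>e \<ge> 1/4\<close> its only root in the interval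
  is the fixed point \<open>r\<close>; for \<open>e < 1/4\<close> the fixed point repels and every even orbit stays on its side
  of \<open>r\<close>, which selects the periodic point.  Since \<open>x\<^sub>1 + x\<^sub>2 + x\<^sub>3 = 1\<close>, it remains to follow
  \<open>x\<^sub>1\<close>: along even times it obeys an affine recursion whose coefficient \<open>4 x\<^sub>3 x\<^sub>3'\<close>
  (\<open>x\<^sub>3'\<close> the third coordinate of the image under \<open>V\<close>) has a limit below 1.
\<close>

section \<open>From convergence of the third coordinate to convergence on the simplex\<close>

text \<open>The error \<open>w n - z\<close> is multiplied by \<open>A n\<close>, eventually bounded
  by some \<open>\<rho>\<close> < 1 in absolute value, and receives a forcing term
  \<open>A n * z + B n - z\<close> that tends to 0 because \<open>z\<close> is fixed by the limiting
  recursion.\<close>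

lemma affine_recursion_tendsto:
  fixes w :: "nat \<Rightarrow> real"
  assumes rec: "\<And>n. w (Suc n) = A n * w n + B n"
    and A: "A \<longlonglongrightarrow> a" and B: "B \<longlonglongrightarrow> b" and a: "\<bar>a\<bar> < 1" and z: "z = a * z + b"
  shows "w \<longlonglongrightarrow> z"
proof (rule LIMSEQ_I)
  fix r :: real assume r: "r > 0"
  obtain \<rho> where \<rho>: "\<bar>a\<bar> < \<rho>" "\<rho> < 1" using dense[OF a] by blast
  then have \<rho>0: "0 < \<rho>" by linarith
  have "(\<lambda>n. A n * z + B n) \<longlonglongrightarrow> a * z + b"
    by (intro tendsto_intros A B)
  then have "(\<lambda>n. \<bar>A n * z + B n - z\<bar>) \<longlonglongrightarrow> 0"
    by (simp add: LIM_zero tendsto_rabs_zero flip: z)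
  \<comment> \<open>Forcing terms below this constant, damped by \<open>\<rho>\<close> at each step,
    add up to at most \<open>r / 2\<close> by the geometric series; the other half of
    \<open>r\<close> is left for the decaying initial error.\<close>
  moreover have "r * (1 - \<rho>) / 2 > 0" using r \<rho> by simp
  ultimately have "\<forall>\<^sub>F n in sequentially. \<bar>A n * z + B n - z\<bar> < r * (1 - \<rho>) / 2"
    by (rule order_tendstoD(2))
  moreover have "\<forall>\<^sub>F n in sequentially. \<bar>A n\<bar> < \<rho>"
    by (rule order_tendstoD(2)[OF tendsto_rabs[OF A] \<rho>(1)])
  ultimately have "\<forall>\<^sub>F n in sequentially. \<bar>A n * z + B n - z\<bar> < r * (1 - \<rho>) / 2 \<and> \<bar>A n\<bar> < \<rho>"
    by (rule eventually_conj)
  then obtain N where N: "\<And>n. n \<ge> N \<Longrightarrow> \<bar>A n * z + B n - z\<bar> < r * (1 - \<rho>) / 2"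
    "\<And>n. n \<ge> N \<Longrightarrow> \<bar>A n\<bar> < \<rho>"
    unfolding eventually_sequentially by blast
  have bound: "\<bar>w (N + j) - z\<bar> \<le> \<rho> ^ j * \<bar>w N - z\<bar> + r / 2" for j
  proof (induction j)
    case 0
    then show ?case using r by simp
  next
    case (Suc j)
    have "w (N + Suc j) - z = A (N + j) * (w (N + j) - z) + (A (N + j) * z + B (N + j) - z)"
      by (simp add: rec algebra_simps)
    also have "\<bar>\<dots>\<bar> \<le> \<bar>A (N + j)\<bar> * \<bar>w (N + j) - z\<bar> + \<bar>A (N + j) * z + B (N + j) - z\<bar>"
      using abs_triangle_ineq by (metis abs_mult)
    also have "\<dots> \<le> \<rho> * (\<rho> ^ j * \<bar>w N - z\<bar> + r / 2) + r * (1 - \<rho>) / 2"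
      using N[of "N + j"] Suc \<rho>0 by (intro add_mono mult_mono) auto
    also have "\<dots> = \<rho> ^ Suc j * \<bar>w N - z\<bar> + r / 2"
      by (simp add: field_simps)
    finally show ?case .
  qed
  have "(\<lambda>j. \<rho> ^ j * \<bar>w N - z\<bar>) \<longlonglongrightarrow> 0"
    using \<rho> \<rho>0 by (intro tendsto_mult_left_zero LIMSEQ_power_zero) simp
  then have "\<forall>\<^sub>F j in sequentially. \<rho> ^ j * \<bar>w N - z\<bar> < r / 2"
    by (rule order_tendstoD(2)) (use r in simp)
  then obtain M where M: "\<And>j. j \<ge> M \<Longrightarrow> \<rho> ^ j * \<bar>w N - z\<bar> < r / 2"
    unfolding eventually_sequentially by blast
  have "norm (w n - z) < r" if "n \<ge> N + M" for n
  proof -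
    have "M \<le> n - N" "N + (n - N) = n" using that by linarith+
    then show ?thesis using bound[of "n - N"] M[of "n - N"] by simp
  qed
  then show "\<exists>no. \<forall>n\<ge>no. norm (w n - z) < r" by blast
qed

lemma tendsto_V:
  assumes "(f \<longlongrightarrow> z) F"
  shows "((\<lambda>n. V c d e (f n)) \<longlongrightarrow> V c d e z) F"
proof (rule vec_tendstoI)
  fix i :: 3
  have f: "((\<lambda>n. f n $ j) \<longlongrightarrow> z $ j) F" for j
    by (rule tendsto_vec_nth[OF assms])
  show "((\<lambda>n. V c d e (f n) $ i) \<longlongrightarrow> V c d e z $ i) F"
    using exhaust_3[of i] by (elim disjE) (auto intro!: tendsto_intros f)
qed

lemma funpow_V_in_S2:
  assumes "c \<ge> 0" "d \<ge> 0" "e \<ge> 0" "c + d + e = 1" "x \<in> S2"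
  shows "(V c d e ^^ n) x \<in> S2"
  by (induction n) (use assms V_in_S2 in auto)

text \<open>One step feeds the first coordinate from the second and vice versa, so over two steps
  the second coordinate drops out, and the first obeys an affine recursion driven by third
  coordinates only.\<close>

lemma V_V_nth_1:
  "V c d e (V c d e x) $ 1 = 4 * x $ 3 * V c d e x $ 3 * x $ 1
    + (c * (V c d e x $ 3)\<^sup>2 + 2 * d * (x $ 3)\<^sup>2 * V c d e x $ 3)"
  unfolding V_nth(1)[of c d e "V c d e x"] V_nth(2) by (simp add: algebra_simps)

text \<open>This leaves a one-dimensional problem. The third coordinates make the coefficients of
  the two-step recursion converge, which settles the first coordinate; the second follows from the
  sum, and the odd times from continuity of \<open>V\<close>. The hypothesis \<open>small\<close>
  says that the limiting coefficient is below 1.\<close>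

lemma V_even_iterates_tendsto:
  assumes par: "c \<ge> 0" "d \<ge> 0" "e \<ge> 0" "c + d + e = 1"
    and x: "x \<in> S2" and z: "z \<in> S2" "V c d e (V c d e z) = z"
    and small: "4 * z $ 3 * V c d e z $ 3 < 1"
    and third: "(\<lambda>k. (V c d e ^^ (2 * k)) x $ 3) \<longlonglongrightarrow> z $ 3"
  shows "(\<lambda>k. (V c d e ^^ (2 * k)) x) \<longlonglongrightarrow> z"
    and "(\<lambda>k. (V c d e ^^ (2 * k + 1)) x) \<longlonglongrightarrow> V c d e z"
proof -
  define X where "X = (\<lambda>k. (V c d e ^^ (2 * k)) x)"
  have X: "X k \<in> S2" for k
    unfolding X_def by (rule funpow_V_in_S2[OF par x])
  have X3: "(\<lambda>k. X k $ 3) \<longlonglongrightarrow> z $ 3" using third by (simp add: X_def)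
  have VX3: "(\<lambda>k. V c d e (X k) $ 3) \<longlonglongrightarrow> V c d e z $ 3"
    unfolding V_nth(3) by (intro tendsto_intros X3)
  have "V c d e z $ 3 \<ge> 0" "z $ 3 \<ge> 0"
    using V_in_S2[OF par z(1)] z(1) by (auto simp: S2_def)
  then have a: "\<bar>4 * z $ 3 * V c d e z $ 3\<bar> < 1"
    using small by (simp only: abs_of_nonneg mult_nonneg_nonneg zero_le_numeral)
  have X1: "(\<lambda>k. X k $ 1) \<longlonglongrightarrow> z $ 1"
  proof (rule affine_recursion_tendsto[OF _ _ _ a])
    show "X (Suc n) $ 1 = 4 * X n $ 3 * V c d e (X n) $ 3 * X n $ 1
        + (c * (V c d e (X n) $ 3)\<^sup>2 + 2 * d * (X n $ 3)\<^sup>2 * V c d e (X n) $ 3)" for n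
      using V_V_nth_1 by (simp only: X_def mult_Suc_right add_2_eq_Suc funpow.simps o_apply)
    show "z $ 1 = 4 * z $ 3 * V c d e z $ 3 * z $ 1
        + (c * (V c d e z $ 3)\<^sup>2 + 2 * d * (z $ 3)\<^sup>2 * V c d e z $ 3)"
      using V_V_nth_1[of c d e z] unfolding z(2) .
  qed (intro tendsto_intros X3 VX3)+
  have "(\<lambda>k. 1 - X k $ 1 - X k $ 3) \<longlonglongrightarrow> 1 - z $ 1 - z $ 3"
    by (intro tendsto_intros X1 X3)
  moreover have "1 - y $ 1 - y $ 3 = y $ 2" if "y \<in> S2" for y
    using that by (simp add: S2_def)
  ultimately have X2: "(\<lambda>k. X k $ 2) \<longlonglongrightarrow> z $ 2" using X z(1) by simp
  show lim: "(\<lambda>k. (V c d e ^^ (2 * k)) x) \<longlonglongrightarrow> z"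
    unfolding X_def[symmetric]
  proof (rule vec_tendstoI)
    show "(\<lambda>k. X k $ i) \<longlonglongrightarrow> z $ i" for i
      using exhaust_3[of i] X1 X2 X3 by auto
  qed
  show "(\<lambda>k. (V c d e ^^ (2 * k + 1)) x) \<longlonglongrightarrow> V c d e z"
    using tendsto_V[OF lim, of c d e] by simp
qed

lemma tendsto_even_odd:
  fixes f :: "nat \<Rightarrow> 'a::topological_space"
  assumes "(\<lambda>k. f (2 * k)) \<longlonglongrightarrow> l" "(\<lambda>k. f (2 * k + 1)) \<longlonglongrightarrow> l"
  shows "f \<longlonglongrightarrow> l"
proof (rule topological_tendstoI)
  fix S assume S: "open S" "l \<in> S"
  obtain M N where "\<And>k. k \<ge> M \<Longrightarrow> f (2 * k) \<in> S" "\<And>k. k \<ge> N \<Longrightarrow> f (2 * k + 1) \<in> S"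
    using topological_tendstoD[OF assms(1) S] topological_tendstoD[OF assms(2) S]
    unfolding eventually_sequentially by blast
  then have "f n \<in> S" if "n \<ge> 2 * (M + N) + 1" for n
    using that by (cases "even n") (auto elim!: evenE oddE)
  then show "\<forall>\<^sub>F n in sequentially. f n \<in> S"
    unfolding eventually_sequentially by blast
qed

lemma V_iterates_tendsto_fixed_point:
  assumes par: "c \<ge> 0" "d \<ge> 0" "e \<ge> 0" "e < 1" "c + d + e = 1" and x: "x \<in> S2"
    and third: "(\<lambda>k. (V c d e ^^ (2 * k)) x $ 3) \<longlonglongrightarrow> x_star c d e $ 3"
  shows "(\<lambda>n. (V c d e ^^ n) x) \<longlonglongrightarrow> x_star c d e"
proof -
  note st = x_star[OF par]
  define t where "t = x_star c d e $ 3"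
  have t: "0 \<le> t" "t \<le> 1" and fx: "t = (1 - t)\<^sup>2 + e * t\<^sup>2"
    using st(1) V_nth(3)[of c d e "x_star c d e"] unfolding st(2) by (auto simp: S2_def t_def)
  \<comment> \<open>Since e < 1, the fixed point equation gives t < (1 - t)^2 + t^2, that is (2t -
    1)(t - 1) > 0, which fails on [1/2, 1]. The bound puts the two-step coefficient 4 t^2 below
    1.\<close>
  have "t < 1/2"
  proof (rule ccontr)
    assume "\<not> t < 1/2"
    then have "e * t\<^sup>2 < t\<^sup>2" and "(2 * t - 1) * (t - 1) \<le> 0"
      using par t by (auto intro: mult_nonneg_nonpos)
    then show False using fx by (simp add: power2_eq_square algebra_simps)
  qed
  then have "4 * t * t < 1" using mult_strict_mono[of t "1/2" t "1/2"] t by simp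
  then have "4 * x_star c d e $ 3 * V c d e (x_star c d e) $ 3 < 1"
    unfolding st(2) t_def .
  note lims = V_even_iterates_tendsto[OF par(1-3,5) x st(1) _ this third, unfolded st(2), OF refl]
  show ?thesis by (rule tendsto_even_odd[OF lims])
qed

section \<open>Dynamics of the real quadratic map u^2 - k\<close>

text \<open>The first factor vanishes at fixed points; the second, of discriminant 4k - 3, carries
  the points of period two. Hence the threshold k = 3/4, which is e = 1/4.\<close>

lemma quadratic_double_step:
  fixes u k :: real
  shows "(u\<^sup>2 - k)\<^sup>2 - k - u = (u\<^sup>2 - k - u) * (u\<^sup>2 + u + 1 - k)"
  by algebra

lemma quadratic_double_step_mono:
  fixes u v k :: real
  assumes "0 \<le> k" "k \<le> 1" "- k \<le> u" "u \<le> v" "v \<le> 0"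
  shows "(u\<^sup>2 - k)\<^sup>2 - k \<le> (v\<^sup>2 - k)\<^sup>2 - k"
proof -
  have "v\<^sup>2 \<le> u\<^sup>2" using assms by (simp add: abs_le_square_iff[symmetric])
  moreover have "u\<^sup>2 \<le> k\<^sup>2" using assms by (simp add: abs_le_square_iff[symmetric])
  \<comment> \<open>Here k <= 1 keeps the images nonpositive, so that the second squaring reverses
    the order again.\<close>
  moreover have "k\<^sup>2 \<le> k" using assms by (simp add: power2_eq_square mult_left_le)
  ultimately have "v\<^sup>2 - k \<le> u\<^sup>2 - k" "u\<^sup>2 - k \<le> 0" by linarith+
  then have "\<bar>u\<^sup>2 - k\<bar> \<le> \<bar>v\<^sup>2 - k\<bar>" by linarith
  then show ?thesis by (simp add: abs_le_square_iff)
qed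

text \<open>Squaring forgets the sign, so all of [-k, k] is mapped into [-k, 0]; the positive half
  is needed for orbits that start outside [-k, 0].\<close>

lemma quadratic_interval_invariant:
  fixes u k :: real
  assumes "k \<le> 1" "- k \<le> u" "u \<le> k"
  shows "- k \<le> u\<^sup>2 - k" "u\<^sup>2 - k \<le> 0"
proof -
  have "u\<^sup>2 \<le> k\<^sup>2" using assms by (simp add: abs_le_square_iff[symmetric])
  moreover have "k\<^sup>2 \<le> k" using assms by (simp add: power2_eq_square mult_left_le)
  ultimately show "u\<^sup>2 - k \<le> 0" by linarith
qed simp

lemma quadratic_orbit_even_converges:
  fixes u :: "nat \<Rightarrow> real" and k :: real
  assumes rec: "\<And>n. u (Suc n) = (u n)\<^sup>2 - k" and k: "0 \<le> k" "k \<le> 1"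
    and init: "- k \<le> u 0" "u 0 \<le> 0"
  obtains L where "(\<lambda>n. u (2 * n)) \<longlonglongrightarrow> L" "L \<le> 0"
    "(L\<^sup>2 - k - L) * (L\<^sup>2 + L + 1 - k) = 0"
proof -
  define v where "v n = u (2 * n)" for n
  have bd: "- k \<le> u n \<and> u n \<le> 0" for n
  proof (induction n)
    case (Suc n)
    then show ?case using quadratic_interval_invariant[of k "u n"] k by (simp add: rec)
  qed (use init in simp)
  have vrec: "v (Suc n) = ((v n)\<^sup>2 - k)\<^sup>2 - k" for n
    by (simp add: v_def rec)
  have vbd: "- k \<le> v n" "v n \<le> 0" for n using bd by (auto simp: v_def)
  \<comment> \<open>The first comparison fixes the direction, and the increasing double step
    propagates it.\<close>
  have mono: "incseq v \<or> decseq v"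
  proof (cases "v 0 \<le> v 1")
    case True
    have "v n \<le> v (Suc n)" for n
    proof (induction n)
      case (Suc n)
      then show ?case
        using quadratic_double_step_mono[OF k vbd(1) Suc vbd(2)] by (simp flip: vrec)
    qed (use True in simp)
    then show ?thesis by (simp add: incseq_SucI)
  next
    case False
    have "v (Suc n) \<le> v n" for n
    proof (induction n)
      case (Suc n)
      then show ?case
        using quadratic_double_step_mono[OF k vbd(1) Suc vbd(2)] by (simp flip: vrec)
    qed (use False in simp)
    then show ?thesis by (simp add: decseq_SucI)
  qed
  have "norm (v n) \<le> k" for n using vbd[of n] by simp
  then have "Bseq v" by (rule BseqI')
  then obtain L where L: "v \<longlonglongrightarrow> L"
    using mono Bseq_monoseq_convergent[of v] by (auto simp: monoseq_iff convergent_def)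
  have "(\<lambda>n. ((v n)\<^sup>2 - k)\<^sup>2 - k) \<longlonglongrightarrow> (L\<^sup>2 - k)\<^sup>2 - k" by (intro tendsto_intros L)
  then have "L = (L\<^sup>2 - k)\<^sup>2 - k"
    using LIMSEQ_Suc[OF L] unfolding vrec by (rule LIMSEQ_unique[symmetric])
  then have "(L\<^sup>2 - k - L) * (L\<^sup>2 + L + 1 - k) = 0"
    using quadratic_double_step[of L k] by simp
  moreover have "L \<le> 0" using LIMSEQ_le_const2[OF L] vbd(2) by blast
  ultimately show ?thesis using that L unfolding v_def by blast
qed

lemma quadratic_orbit_tendsto_fixed_point:
  fixes u :: "nat \<Rightarrow> real" and k r :: real
  assumes rec: "\<And>n. u (Suc n) = (u n)\<^sup>2 - k" and k: "0 \<le> k" "k \<le> 3/4"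
    and init: "- k \<le> u 0" "u 0 \<le> 0" and r: "r\<^sup>2 - k = r" "r \<le> 0"
  shows "(\<lambda>n. u (2 * n)) \<longlonglongrightarrow> r"
proof -
  have "k \<le> 1" using k by simp
  from quadratic_orbit_even_converges[OF rec k(1) this init]
  obtain L where L: "(\<lambda>n. u (2 * n)) \<longlonglongrightarrow> L" "L \<le> 0"
    "(L\<^sup>2 - k - L) * (L\<^sup>2 + L + 1 - k) = 0" by blast
  have "L\<^sup>2 - k - L = 0"
  proof (rule ccontr)
    assume ne: "L\<^sup>2 - k - L \<noteq> 0"
    with L(3) have "L\<^sup>2 + L + 1 - k = 0" by simp
    \<comment> \<open>Completing the square leaves only k = 3/4 and L = -1/2, where the period-two
      root coincides with the fixed point.\<close>
    then have "(L + 1/2)\<^sup>2 + (3/4 - k) = 0" by (simp add: power2_eq_square algebra_simps)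
    moreover have "(L + 1/2)\<^sup>2 \<ge> 0" by simp
    ultimately have "(L + 1/2)\<^sup>2 = 0" "k = 3/4" using k by linarith+
    then have "L = -1/2" by simp
    then show False using ne \<open>k = 3/4\<close> by (simp add: power2_eq_square)
  qed
  \<comment> \<open>Both \<open>L\<close> and \<open>r\<close> solve u^2 - u - k = 0, whose roots
    sum to 1, and the root 1 - r is positive.\<close>
  with r have "(L - r) * (L + r - 1) = 0" by (simp add: power2_eq_square algebra_simps)
  then have "L = r" using L(2) r(2) by simp
  then show ?thesis using L(1) by simp
qed

text \<open>On [-1/2, 0] the product (r + 1/2)(r - 3/2) = r^2 - r - 3/4 = k - 3/4 would be
  nonpositive. The bound means that the derivative 2r at the fixed point is below -1, so it
  repels.\<close>

lemma quadratic_fixed_point_less: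
  fixes r k :: real
  assumes "3/4 < k" "r\<^sup>2 - k = r" "r \<le> 0"
  shows "r < - 1/2"
proof (rule ccontr)
  assume "\<not> r < - 1/2"
  then have "(r + 1/2) * (r - 3/2) \<le> 0" using assms(3) by (intro mult_nonneg_nonpos) auto
  then show False using assms(1,2) by (simp add: power2_eq_square algebra_simps)
qed

text \<open>Apply u^2 - r^2 = (u + r)(u - r) twice. The sign of the multiplier tells whether the
  side of \<open>r\<close> is kept, its size whether the distance to \<open>r\<close> grows.\<close>

lemma quadratic_double_step_diff:
  fixes r k u :: real
  assumes "r\<^sup>2 - k = r"
  shows "(u\<^sup>2 - k)\<^sup>2 - k - r = (u + r) * (u\<^sup>2 - k + r) * (u - r)"
proof -
  have k: "k = r\<^sup>2 - r" using assms by simp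
  show ?thesis unfolding k by algebra
qed

lemma quadratic_orbit_tendsto_periodic_point:
  fixes u :: "nat \<Rightarrow> real" and k r s :: real
  assumes rec: "\<And>n. u (Suc n) = (u n)\<^sup>2 - k" and k: "3/4 < k" "k \<le> 1"
    and init: "- k \<le> u 0" "u 0 \<le> 0"
    and r: "r\<^sup>2 - k = r" "r \<le> 0" and s: "s\<^sup>2 = 4 * k - 3" "0 < s"
  shows "u 0 < r \<Longrightarrow> (\<lambda>n. u (2 * n)) \<longlonglongrightarrow> (- 1 - s) / 2"
    and "u 0 > r \<Longrightarrow> (\<lambda>n. u (2 * n)) \<longlonglongrightarrow> (- 1 + s) / 2"
proof -
  note r1 = quadratic_fixed_point_less[OF k(1) r]
  have k0: "0 \<le> k" using k by simp
  have bd: "- k \<le> u n \<and> u n \<le> 0" for n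
  proof (induction n)
    case (Suc n)
    then show ?case using quadratic_interval_invariant[of k "u n"] k by (simp add: rec)
  qed (use init in simp)
  \<comment> \<open>\<open>m n\<close> is the factor by which a double step multiplies the signed
    distance \<open>D n\<close> from \<open>r\<close>. Both of its factors are negative, since the
    orbit is nonpositive and \<open>r\<close> < 0, so \<open>D\<close> keeps its sign.\<close>
  define D m where "D n = u (2 * n) - r" and "m n = (u (2 * n) + r) * ((u (2 * n))\<^sup>2 - k + r)" for n
  have D: "D (Suc n) = m n * D n" for n
    using quadratic_double_step_diff[OF r(1), of "u (2 * n)"] by (simp add: D_def m_def rec)
  have m: "m n > 0" for n
    unfolding m_def using bd[of "2 * n"] bd[of "Suc (2 * n)"] r1
    by (intro mult_neg_neg) (auto simp: rec)
  obtain L where L: "(\<lambda>n. u (2 * n)) \<longlonglongrightarrow> L" "L \<le> 0"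
    "(L\<^sup>2 - k - L) * (L\<^sup>2 + L + 1 - k) = 0"
    using quadratic_orbit_even_converges[OF rec k0 k(2) init] by blast
  have L_eq: "L = (- 1 - s) / 2 \<or> L = (- 1 + s) / 2" if "u 0 \<noteq> r"
  proof -
    \<comment> \<open>Repulsion alone would not exclude an orbit that lands exactly on
      \<open>r\<close>.\<close>
    have D0: "D n \<noteq> 0" for n
    proof (induction n)
      case 0
      then show ?case using that by (simp add: D_def)
    next
      case (Suc n)
      then show ?case using m[of n] by (simp add: D)
    qed
    have "L \<noteq> r"
      \<comment> \<open>\<open>r\<close> repels: its multiplier \<open>4 r\<^sup>2\<close> exceeds 1.\<close>
    proof
      assume Lr: "L = r"
      have "m \<longlonglongrightarrow> (r + r) * (r\<^sup>2 - k + r)"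
        unfolding m_def by (intro tendsto_intros L(1)[unfolded Lr])
      also have "(r + r) * (r\<^sup>2 - k + r) = 4 * r\<^sup>2"
        using r(1) by (simp add: power2_eq_square)
      finally have "m \<longlonglongrightarrow> 4 * r\<^sup>2" .
      moreover have "1 < 4 * r\<^sup>2"
        using mult_neg_neg[of "r + 1/2" "r - 1/2"] r1 by (simp add: power2_eq_square algebra_simps)
      ultimately have "\<forall>\<^sub>F n in sequentially. 1 < m n"
        by (rule order_tendstoD(1))
      then obtain N where N: "\<And>n. n \<ge> N \<Longrightarrow> 1 < m n"
        unfolding eventually_sequentially by blast
      have "\<bar>D N\<bar> \<le> \<bar>D (N + j)\<bar>" for j
      proof (induction j)
        case (Suc j)
        have "\<bar>D (N + j)\<bar> \<le> \<bar>D (N + Suc j)\<bar>"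
          using N[of "N + j"] by (simp add: D abs_mult mult_le_cancel_right1)
        then show ?case using Suc by linarith
      qed simp
      moreover have "D \<longlonglongrightarrow> 0" unfolding D_def using L(1) Lr by (simp add: LIM_zero)
      then have "(\<lambda>j. \<bar>D (N + j)\<bar>) \<longlonglongrightarrow> 0"
        using LIMSEQ_ignore_initial_segment[of D 0 N] tendsto_rabs_zero by (simp add: add.commute)
      ultimately have "\<bar>D N\<bar> \<le> 0" by (intro LIMSEQ_le_const) auto
      then show False using D0 by simp
    qed
    moreover have "L + r - 1 < 0" using L(2) r(2) by simp
    ultimately have "(L - r) * (L + r - 1) \<noteq> 0" by simp
    moreover have "(L - r) * (L + r - 1) = L\<^sup>2 - k - L"
      using r(1) by (simp add: power2_eq_square algebra_simps)
    ultimately have "L\<^sup>2 + L + 1 - k = 0" using L(3) by simp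
    \<comment> \<open>The product is (2L + 1)^2 - s^2 with s^2 the discriminant 4k - 3.\<close>
    then have "(2 * L + 1 + s) * (2 * L + 1 - s) = 0" using s(1) by algebra
    then show ?thesis by auto
  qed
  show "(\<lambda>n. u (2 * n)) \<longlonglongrightarrow> (- 1 - s) / 2" if "u 0 < r"
  proof -
    have "u (2 * n) \<le> r" for n
    proof -
      have "D n < 0"
        by (induction n) (use that m in \<open>simp_all add: D mult_pos_neg, simp add: D_def\<close>)
      then show ?thesis by (simp add: D_def)
    qed
    then have "L \<le> r" using LIMSEQ_le_const2[OF L(1)] by blast
    \<comment> \<open>The other root exceeds -1/2 and hence \<open>r\<close>.\<close>
    then have "L = (- 1 - s) / 2" using L_eq that r1 s(2) by auto
    then show ?thesis using L(1) by blast
  qed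
  show "(\<lambda>n. u (2 * n)) \<longlonglongrightarrow> (- 1 + s) / 2" if "u 0 > r"
  proof -
    have "u (2 * n) \<ge> r" for n
    proof -
      have "D n > 0"
        by (induction n) (use that m in \<open>simp_all add: D, simp add: D_def\<close>)
      then show ?thesis by (simp add: D_def)
    qed
    then have Lr: "L \<ge> r" using LIMSEQ_le_const[OF L(1)] by blast
    \<comment> \<open>Otherwise s <= -(1 + 2r), and squaring with r^2 = r + k gives 4k - 3 <= 4k + 1
      + 8r, against r < -1/2.\<close>
    have "(- 1 - s) / 2 < r"
    proof (rule ccontr)
      assume "\<not> (- 1 - s) / 2 < r"
      then have "s \<le> - (1 + 2 * r)" by simp
      then have "s\<^sup>2 \<le> (1 + 2 * r)\<^sup>2" using s(2) r1
        by (intro abs_le_square_iff[THEN iffD1]) simp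
      then show False using s(1) r(1) r1 by (simp add: power2_eq_square algebra_simps)
    qed
    then have "L = (- 1 + s) / 2" using Lr L_eq that by linarith
    then show ?thesis using L(1) by blast
  qed
qed

text \<open>With k = 1 - e, the interval [-1, 1 - k] is the full range of (1 + e) x_3 - 1 over the
  simplex. Two steps carry it through [-k, 1 - k] into [-k, 0] without changing the side of
  \<open>r\<close>.\<close>

lemma quadratic_orbit_tendsto_periodic_point':
  fixes u :: "nat \<Rightarrow> real" and k r s :: real
  assumes rec: "\<And>n. u (Suc n) = (u n)\<^sup>2 - k" and k: "3/4 < k" "k \<le> 1"
    and init: "- 1 \<le> u 0" "u 0 \<le> 1 - k"
    and r: "r\<^sup>2 - k = r" "r \<le> 0" and s: "s\<^sup>2 = 4 * k - 3" "0 < s"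
  shows "u 0 < r \<Longrightarrow> (\<lambda>n. u (2 * n)) \<longlonglongrightarrow> (- 1 - s) / 2"
    and "u 0 > r \<Longrightarrow> (\<lambda>n. u (2 * n)) \<longlonglongrightarrow> (- 1 + s) / 2"
proof -
  define v where "v n = u (Suc (Suc n))" for n
  have vrec: "v (Suc n) = (v n)\<^sup>2 - k" for n by (simp add: v_def rec)
  have "(u 0)\<^sup>2 \<le> 1" using init k by (simp add: abs_square_le_1)
  then have u1: "- k \<le> u 1" "u 1 \<le> 1 - k" by (simp_all add: rec)
  have v0: "- k \<le> v 0" "v 0 \<le> 0"
    using quadratic_interval_invariant[of k "u 1"] u1 k by (simp_all add: v_def rec[of "Suc 0"])
  have lim: "(\<lambda>n. u (2 * n)) \<longlonglongrightarrow> l" if "(\<lambda>n. v (2 * n)) \<longlonglongrightarrow> l" for l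
    by (rule LIMSEQ_imp_Suc) (use that in \<open>simp add: v_def\<close>)
  note r1 = quadratic_fixed_point_less[OF k(1) r]
  have "v 0 - r = (u 0 + r) * (u 1 + r) * (u 0 - r)"
    using quadratic_double_step_diff[OF r(1), of "u 0"] by (simp add: v_def rec)
  moreover have "(u 0 + r) * (u 1 + r) > 0"
    using init u1 r1 k by (intro mult_neg_neg) auto
  ultimately have side: "u 0 < r \<Longrightarrow> v 0 < r" "u 0 > r \<Longrightarrow> v 0 > r"
    by (metis diff_less_0_iff_less mult_pos_neg, metis diff_gt_0_iff_gt mult_pos_pos)
  note v_lim = quadratic_orbit_tendsto_periodic_point[of v, OF vrec k v0 r s]
  show "u 0 < r \<Longrightarrow> (\<lambda>n. u (2 * n)) \<longlonglongrightarrow> (- 1 - s) / 2"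
    and "u 0 > r \<Longrightarrow> (\<lambda>n. u (2 * n)) \<longlonglongrightarrow> (- 1 + s) / 2"
    using lim v_lim side by blast+
qed

section \<open>Conjugation and return to the simplex\<close>

text \<open>In (1 + e) x^2 - 2x + 1, scaling by 1 + e makes the quadratic monic and the shift by 1
  removes its linear term.\<close>

lemma V_third_conjugate:
  "(1 + e) * V c d e x $ 3 - 1 = ((1 + e) * x $ 3 - 1)\<^sup>2 - (1 - e)"
  unfolding V_nth by algebra

text \<open>For e < 1/4 the two sides of the fixed level are treated separately, because even
  iterates keep their side: by \<open>even_iterates_not_uniform\<close> no single limit can serve
  both.\<close>

theorem theorem3:
  fixes c d e :: real
  assumes "c \<ge> 0" "d \<ge> 0" "e \<ge> 0" "c + d + e = 1" "e < 1"
  shows "(e < 1/4 \<longrightarrow>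
      (\<exists>U. openin (top_of_set S2) U \<and> x_bar c d e \<in> U \<and> x_barbar c d e \<in> U \<and>
        (\<forall>x\<in>U.
          (x $ 3 > x_star c d e $ 3 \<longrightarrow>
             (\<lambda>k. (V c d e ^^ (2 * k)) x) \<longlonglongrightarrow> x_bar c d e \<and>
             (\<lambda>k. (V c d e ^^ (2 * k + 1)) x) \<longlonglongrightarrow> x_barbar c d e) \<and>
          (x $ 3 < x_star c d e $ 3 \<longrightarrow>
             (\<lambda>k. (V c d e ^^ (2 * k)) x) \<longlonglongrightarrow> x_barbar c d e \<and>
             (\<lambda>k. (V c d e ^^ (2 * k + 1)) x) \<longlonglongrightarrow> x_bar c d e) \<and>
          (x $ 3 = x_star c d e $ 3 \<longrightarrow>
             (\<lambda>n. (V c d e ^^ n) x) \<longlonglongrightarrow> x_star c d e))))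
    \<and> (e \<ge> 1/4 \<longrightarrow>
      (\<exists>U. openin (top_of_set S2) U \<and> x_star c d e \<in> U \<and>
        (\<forall>x\<in>U. (\<lambda>n. (V c d e ^^ n) x) \<longlonglongrightarrow> x_star c d e)))"
proof -
  define k u where "k = 1 - e" and "u x n = (1 + e) * (V c d e ^^ n) x $ 3 - 1" for x n
  define r s where "r = (1 + e) * x_star c d e $ 3 - 1" and "s = sqrt (1 - 4 * e)"
  note par = assms(1-3,5,4)
  have e1: "1 + e > 0" using assms by simp
  have rec: "u x (Suc n) = (u x n)\<^sup>2 - k" for x n
    unfolding u_def k_def by (simp only: funpow.simps o_apply V_third_conjugate)
  have k: "0 \<le> k" "k \<le> 1" using assms by (simp_all add: k_def)
  have r: "r\<^sup>2 - k = r"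
    using V_third_conjugate[of e c d "x_star c d e"] unfolding x_star(2)[OF par] r_def k_def by (rule sym)
  \<comment> \<open>In the new coordinate the fixed point is (1 - sqrt (5 - 4e)) / 2, hence
    negative.\<close>
  have "sqrt (5 - 4 * e) > 1" using assms by simp
  moreover have half: "(1 + e) * (t / (2 * (1 + e))) = t / 2" for t
    using e1 by (metis less_irrefl mult.commute nonzero_mult_divide_mult_cancel_left times_divide_eq_right)
  ultimately have r0: "r < 0" unfolding r_def x_star(3)[OF par] half by simp
  have u0: "u x 0 = (1 + e) * x $ 3 - 1" for x by (simp add: u_def)
  have side: "u x 0 < r \<longleftrightarrow> x $ 3 < x_star c d e $ 3" "u x 0 > r \<longleftrightarrow> x $ 3 > x_star c d e $ 3" for x
    using e1 by (simp_all add: u0 r_def)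
  have third: "(\<lambda>n. (V c d e ^^ (2 * n)) x $ 3) \<longlonglongrightarrow> t"
    if "(\<lambda>n. u x (2 * n)) \<longlonglongrightarrow> l" "l = (1 + e) * t - 1" for x t l
  proof -
    have "(\<lambda>n. (u x (2 * n) + 1) / (1 + e)) \<longlonglongrightarrow> (l + 1) / (1 + e)"
      using e1 by (intro tendsto_intros that) simp
    then show ?thesis using e1 by (simp add: u_def that(2))
  qed
  have star: "(\<lambda>n. (V c d e ^^ n) x) \<longlonglongrightarrow> x_star c d e"
    if "x \<in> S2" "(\<lambda>n. u x (2 * n)) \<longlonglongrightarrow> r" for x
    by (rule V_iterates_tendsto_fixed_point[OF par that(1) third[OF that(2) r_def]])
  have "\<exists>U. openin (top_of_set S2) U \<and> x_bar c d e \<in> U \<and> x_barbar c d e \<in> U \<and>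
        (\<forall>x\<in>U.
          (x $ 3 > x_star c d e $ 3 \<longrightarrow>
             (\<lambda>k. (V c d e ^^ (2 * k)) x) \<longlonglongrightarrow> x_bar c d e \<and>
             (\<lambda>k. (V c d e ^^ (2 * k + 1)) x) \<longlonglongrightarrow> x_barbar c d e) \<and>
          (x $ 3 < x_star c d e $ 3 \<longrightarrow>
             (\<lambda>k. (V c d e ^^ (2 * k)) x) \<longlonglongrightarrow> x_barbar c d e \<and>
             (\<lambda>k. (V c d e ^^ (2 * k + 1)) x) \<longlonglongrightarrow> x_bar c d e) \<and>
          (x $ 3 = x_star c d e $ 3 \<longrightarrow>
             (\<lambda>n. (V c d e ^^ n) x) \<longlonglongrightarrow> x_star c d e))"
    if e4: "e < 1/4"
  \<comment> \<open>The whole simplex, open in itself, is a valid choice here.\<close>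
  proof (intro exI[of _ S2] conjI ballI impI)
    note par' = assms(1-3) e4 assms(4)
    note sw = V_interchanges[OF par']
    note xb = x_bar[OF par'] and xbb = x_barbar[OF par']
    show "openin (top_of_set S2) S2" by simp
    show "x_bar c d e \<in> S2" "x_barbar c d e \<in> S2" by (fact xb xbb)+
    fix x assume x: "x \<in> S2"
    have init: "- 1 \<le> u x 0" "u x 0 \<le> 1 - k"
    proof -
      have "0 \<le> x $ 3" "x $ 3 \<le> 1" using x by (auto simp: S2_def)
      then have "0 \<le> (1 + e) * x $ 3" "(1 + e) * x $ 3 \<le> 1 + e"
        using e1 mult_left_le[of "x $ 3" "1 + e"] by simp_all
      then show "- 1 \<le> u x 0" "u x 0 \<le> 1 - k" by (simp_all add: u0 k_def)
    qed
    have s: "s\<^sup>2 = 4 * k - 3" "0 < s" using e4 by (simp_all add: s_def k_def)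
    have k34: "3/4 < k" using e4 by (simp add: k_def)
    note lim = quadratic_orbit_tendsto_periodic_point'[of "u x", OF rec k34 k(2) init r less_imp_le[OF r0] s]
    have "(- 1 + s) / 2 = (1 + e) * x_bar c d e $ 3 - 1" "(- 1 - s) / 2 = (1 + e) * x_barbar c d e $ 3 - 1"
      unfolding xb(3) xbb(3) x3_bar_def x3_barbar_def s_def half by (simp_all add: field_simps)
    note lims = third[OF lim(2) this(1)] third[OF lim(1) this(2)]
    have small: "4 * x_bar c d e $ 3 * V c d e (x_bar c d e) $ 3 < 1"
      "4 * x_barbar c d e $ 3 * V c d e (x_barbar c d e) $ 3 < 1"
      unfolding sw xb(3) xbb(3) using x3_bar_barbar(4)[OF assms(3) e4] by (simp_all only: mult_ac)
    have vv: "V c d e (V c d e (x_bar c d e)) = x_bar c d e"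
      "V c d e (V c d e (x_barbar c d e)) = x_barbar c d e"
      by (simp_all only: sw)
    note even1 = V_even_iterates_tendsto[OF assms(1-4) x xb(1) vv(1) small(1) lims(1)]
      and even2 = V_even_iterates_tendsto[OF assms(1-4) x xbb(1) vv(2) small(2) lims(2)]
    {
      assume "x $ 3 > x_star c d e $ 3"
      then have "u x 0 > r" by (simp only: side)
      from even1[OF this]
      show "(\<lambda>k. (V c d e ^^ (2 * k)) x) \<longlonglongrightarrow> x_bar c d e"
        and "(\<lambda>k. (V c d e ^^ (2 * k + 1)) x) \<longlonglongrightarrow> x_barbar c d e"
        unfolding sw .
    next
      assume "x $ 3 < x_star c d e $ 3"
      then have "u x 0 < r" by (simp only: side)
      from even2[OF this]
      show "(\<lambda>k. (V c d e ^^ (2 * k)) x) \<longlonglongrightarrow> x_barbar c d e"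
        and "(\<lambda>k. (V c d e ^^ (2 * k + 1)) x) \<longlonglongrightarrow> x_bar c d e"
        unfolding sw .
    next
      assume "x $ 3 = x_star c d e $ 3"
      then have "u x 0 = r" by (simp add: u0 r_def)
      then have "u x n = r" for n
        by (induction n) (simp_all add: rec r)
      then show "(\<lambda>n. (V c d e ^^ n) x) \<longlonglongrightarrow> x_star c d e"
        using star[OF x] by simp
    }
  qed
  moreover have "\<exists>U. openin (top_of_set S2) U \<and> x_star c d e \<in> U \<and>
        (\<forall>x\<in>U. (\<lambda>n. (V c d e ^^ n) x) \<longlonglongrightarrow> x_star c d e)"
    if e4: "e \<ge> 1/4"
  proof (intro exI conjI ballI)
    \<comment> \<open>The two strict inequalities say that \<open>u x 0\<close> and
      \<open>u x 1\<close> are negative. They hold at the fixed point because r < 0 and r^2 - k = r,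
      and they put \<open>u x 1\<close> into [-k, 0].\<close>
    let ?U = "S2 \<inter> {x. (1 + e) * x $ 3 - 1 < 0 \<and> ((1 + e) * x $ 3 - 1)\<^sup>2 < k}"
    have "open {x :: real ^ 3. (1 + e) * x $ 3 - 1 < 0 \<and> ((1 + e) * x $ 3 - 1)\<^sup>2 < k}"
      by (intro open_Collect_conj open_Collect_less continuous_intros)
    then show "openin (top_of_set S2) ?U" by (rule openin_open_Int)
    have "r\<^sup>2 < k" using r r0 by simp
    then show "x_star c d e \<in> ?U"
      using x_star(1)[OF par] r0 unfolding r_def by blast
    fix x assume x: "x \<in> ?U"
    then have "u x 1 \<le> 0" "- k \<le> u x 1" by (simp_all add: rec u0)
    then have u2: "- k \<le> u x 2" "u x 2 \<le> 0"
      using quadratic_interval_invariant[of k "u x 1"] k by (simp_all add: rec numeral_2_eq_2)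
    have "k \<le> 3/4" using e4 by (simp add: k_def)
    \<comment> \<open>\<open>u x 0\<close> may lie below -k, so the orbit is restarted at time 2,
      which unlike time 1 preserves parity.\<close>
    have "(\<lambda>n. u x (Suc (Suc (2 * n)))) \<longlonglongrightarrow> r"
      using quadratic_orbit_tendsto_fixed_point[of "\<lambda>n. u x (Suc (Suc n))" k r,
          OF rec k(1) \<open>k \<le> 3/4\<close> _ _ r less_imp_le[OF r0]] u2
      by (simp add: numeral_2_eq_2)
    then have "(\<lambda>n. u x (2 * n)) \<longlonglongrightarrow> r"
      by (intro LIMSEQ_imp_Suc[of "\<lambda>n. u x (2 * n)"]) simp
    then show "(\<lambda>n. (V c d e ^^ n) x) \<longlonglongrightarrow> x_star c d e"
      using star x by blast
  qed
  ultimately show ?thesis by blast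
qed

end
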